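(* Let $n$ be even and let $\Delta$ be a simplicial complex on $[n]$ with $\Delta=\Delta^*$ such that $\mathrm{Bier}(\Delta)$ is a cs $k$-neighborly sphere for some $2\leq k\leq (n-2)/2$. Suppose there exist distinct $r,\ell\in[n]$ and subsets $C,D\subseteq[n]\setminus\{r,\ell\}$ with $|C|=|D|=(n-2)/2$ such that 1. $C\sqcup\{r\}\in\Delta$ and $[n]\setminus(C\sqcup\{\ell\})\in\Delta$; 2. $D\sqcup\{\ell\}\in\Delta$ and $[n]\setminus(D\sqcup\{r\})\in\Delta$. Then $\mathrm{Bier}(\Delta)$ is not cs-polytopal.
   Context: $[n]=\{1,\dots,n\}$. A simplicial complex $\Delta$ on $[n]$ is a collection of subsets (faces) of $[n]$ closed under inclusion; singletons are not required to be faces. Its Alexander dual is $\Delta^*=\{[n]\setminus\sigma:\sigma\subseteq[n],\ \sigma\notin\Delta\}$. Take $2n$ distinct elements $x_1,\dots,x_n,y_1,\dots,y_n$. The Bier sphere of $\Delta$ is $$\mathrm{Bier}(\Delta)=\{\{x_i: i\in\sigma\}\cup\{y_j: j\in\tau\} : \sigma\in\Delta,\ \tau\in\Delta^*,\ \sigma\cap\tau=\emptyset\},$$ which is a simplicial $(n-2)$-sphere. When $\Delta=\Delta^*$, it is centrally symmetric with antipodal pairs $x_i,y_i$. A simplicial complex is centrally symmetric (cs) if there is an involution $\iota$ on its vertices that maps faces to faces and satisfies $\iota(\sigma)\neq\sigma$ for every nonempty face $\sigma$; $v$ and $\iota(v)$ are called antipodal. A cs simplicial complex is cs $k$-neighborly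 if every set of $k$ of its vertices containing no antipodal pair is a face. A polytope $P\subset\mathbb{R}^m$ is centrally symmetric (cs) if $P=-P$. A cs simplicial sphere is cs-polytopal if it is combinatorially isomorphic to the boundary complex of a cs simplicial polytope. *)

theory Defs
  imports "HOL-Analysis.Analysis"
begin

text \<open>The library's \<^const>\<open>simplicial_complex\<close> is geometric; these are abstract complexes, given by
  their sets of faces. The ground set may be larger than the set of vertices.\<close>

definition complex_on :: "'v set \<Rightarrow> 'v set set \<Rightarrow> bool" where
  "complex_on V K \<longleftrightarrow> K \<subseteq> Pow V \<and> (\<forall>\<sigma>\<in>K. \<forall>\<tau>\<subseteq>\<sigma>. \<tau> \<in> K)"

definition vertices :: "'v set set \<Rightarrow> 'v set" where
  "vertices K = {v. {v} \<in> K}"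

definition complex_iso :: "'v set set \<Rightarrow> 'w set set \<Rightarrow> bool" where
  "complex_iso K L \<longleftrightarrow>
     (\<exists>f. bij_betw f (vertices K) (vertices L) \<and> (`) f ` K = L)"

definition cs_complex :: "('v \<Rightarrow> 'v) \<Rightarrow> 'v set set \<Rightarrow> bool" where
  "cs_complex \<iota> K \<longleftrightarrow>
     complex_on (vertices K) K \<and>
     (\<forall>v\<in>vertices K. \<iota> v \<in> vertices K \<and> \<iota> (\<iota> v) = v) \<and>
     (\<forall>\<sigma>\<in>K. \<iota> ` \<sigma> \<in> K) \<and>
     (\<forall>\<sigma>\<in>K. \<sigma> \<noteq> {} \<longrightarrow> \<iota> ` \<sigma> \<noteq> \<sigma>)"

definition cs_neighborly :: "nat \<Rightarrow> ('v \<Rightarrow> 'v) \<Rightarrow> 'v set set \<Rightarrow> bool" where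
  "cs_neighborly k \<iota> K \<longleftrightarrow>
     cs_complex \<iota> K \<and>
     (\<forall>S\<subseteq>vertices K. finite S \<longrightarrow> card S = k \<longrightarrow> (\<forall>v\<in>S. \<iota> v \<notin> S) \<longrightarrow> S \<in> K)"

definition alexander_dual :: "nat \<Rightarrow> nat set set \<Rightarrow> nat set set" where
  "alexander_dual n \<Delta> = {{1..n} - \<sigma> | \<sigma>. \<sigma> \<subseteq> {1..n} \<and> \<sigma> \<notin> \<Delta>}"

text \<open>The element \<open>x\<^sub>i\<close> is \<open>Inl i\<close> and \<open>y\<^sub>j\<close> is \<open>Inr j\<close>.\<close>

definition bier :: "nat \<Rightarrow> nat set set \<Rightarrow> (nat + nat) set set" where
  "bier n \<Delta> = {\<sigma> <+> \<tau> | \<sigma> \<tau>. \<sigma> \<in> \<Delta> \<and> \<tau> \<in> alexander_dual n \<Delta> \<and> \<sigma> \<inter> \<tau> = {}}"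

definition swap_xy :: "nat + nat \<Rightarrow> nat + nat" where
  "swap_xy = case_sum Inr Inl"

definition simplicial_polytope :: "'a::euclidean_space set \<Rightarrow> bool" where
  "simplicial_polytope P \<longleftrightarrow>
     polytope P \<and> (\<forall>F. F face_of P \<and> F \<noteq> P \<longrightarrow> (\<exists>d. d simplex F))"

text \<open>Each proper face is recorded by its set of vertices. The empty set is a face in the sense of
  \<^const>\<open>face_of\<close>, so it belongs to the boundary complex.\<close>

definition boundary_complex :: "'a::euclidean_space set \<Rightarrow> 'a set set" where
  "boundary_complex P = {{v. v extreme_point_of F} | F. F face_of P \<and> F \<noteq> P}"

text \<open>The type argument fixes the ambient space \<open>\<real>\<^sup>m\<close> with \<open>m = CARD('m)\<close>. A complex is cs-polytopal
  if this holds for some finite type \<open>'m\<close>; a theorem denying it for a type variable \<open>'m\<close> denies it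
  in every dimension. The polytope need not span \<open>\<real>\<^sup>m\<close>.\<close>

definition cs_polytopal_in :: "(real ^ 'm) itself \<Rightarrow> 'v set set \<Rightarrow> bool" where
  "cs_polytopal_in _ K \<longleftrightarrow>
     (\<exists>P :: (real ^ 'm) set.
        simplicial_polytope P \<and> uminus ` P = P \<and> complex_iso K (boundary_complex P))"

end

theory Submission
  imports Defs
begin

text \<open>Let \<open>P\<close> be a centrally symmetric polytope realizing the sphere. Antipodal vertices of \<open>P\<close> lie in
  no common proper face, while 2-neighborliness joins any two vertices of the sphere that are not
  antipodal. Hence the realization is equivariant: if \<open>v\<^sub>i\<close> is the image of \<open>x\<^sub>i\<close>, then \<open>- v\<^sub>i\<close> is the
  image of \<open>y\<^sub>i\<close>. The hypotheses on \<open>C\<close> give two facets that omit the index \<open>l\<close> and differ only by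
  exchanging \<open>x\<^sub>r\<close> for \<open>y\<^sub>r\<close>; each of them spans the linear hull of \<open>P\<close>, so there is a nontrivial
  linear relation \<open>\<Sum> c\<^sub>i v\<^sub>i = 0\<close>. Evaluating on it the difference of the two facet functionals leaves
  only the terms \<open>r\<close> and \<open>l\<close> and yields \<open>\<bar>c\<^sub>r\<bar> < \<bar>c\<^sub>l\<bar>\<close>. The hypotheses on \<open>D\<close> yield the opposite
  inequality.\<close>

section \<open>Facets and proper faces of centrally symmetric polytopes\<close>

lemma symmetric_polytope_facet_functional:
  fixes P :: "'a::euclidean_space set"
  assumes "polytope P" and sym: "uminus ` P = P" and "F facet_of P"
  obtains a where "\<And>x. x \<in> P \<Longrightarrow> a \<bullet> x \<le> 1" and "F = P \<inter> {x. a \<bullet> x = 1}"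
proof -
  have "F exposed_face_of P"
    using exposed_face_of_polyhedron[OF polytope_imp_polyhedron[OF assms(1)]]
      facet_of_imp_face_of[OF assms(3)] by simp
  then obtain a b where ab: "P \<subseteq> {x. a \<bullet> x \<le> b}" "F = P \<inter> {x. a \<bullet> x = b}"
    unfolding exposed_face_of_def by blast
  have neg: "- x \<in> P" if "x \<in> P" for x
    using imageI[OF that, of uminus] sym by simp
  obtain p where p: "p \<in> F"
    using assms(3) unfolding facet_of_def by blast
  have "F \<noteq> P"
    using assms(3) facet_of_irrefl by blast
  then obtain q where q: "q \<in> P" "a \<bullet> q \<noteq> b"
    using ab(2) by blast
  have "a \<bullet> q \<le> b" "a \<bullet> (- q) \<le> b"
    using ab(1) q(1) neg[OF q(1)] by blast+
  \<comment> \<open>The inequality is strict at \<open>q\<close>, so adding it to the one at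
    \<open>- q\<close> gives \<open>0 < 2 * b\<close>. Dividing by \<open>b\<close> then normalizes
    the right-hand side to 1.\<close>
  then have "b > 0"
    using q(2) by simp
  then have scale: "(inverse b *\<^sub>R a) \<bullet> x \<le> 1 \<longleftrightarrow> a \<bullet> x \<le> b"
    "(inverse b *\<^sub>R a) \<bullet> x = 1 \<longleftrightarrow> a \<bullet> x = b" for x
    by (auto simp: field_simps)
  show ?thesis
  proof
    show "(inverse b *\<^sub>R a) \<bullet> x \<le> 1" if "x \<in> P" for x
      using ab(1) that unfolding scale by blast
    show "F = P \<inter> {x. (inverse b *\<^sub>R a) \<bullet> x = 1}"
      using ab(2) unfolding scale .
  qed
qed

text \<open>The hyperplane carrying \<open>F\<close> misses the origin, so adjoining 0 to
  \<open>F\<close> raises the affine dimension by one, back to that of \<open>P\<close>. Hence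
  \<open>span F\<close> and \<open>span P\<close> have the same dimension, and one contains the
  other.\<close>

lemma subset_span_facet:
  fixes P :: "'a::euclidean_space set"
  assumes "F facet_of P" "0 \<in> P" "\<And>x. x \<in> F \<Longrightarrow> a \<bullet> x = 1"
  shows "P \<subseteq> span F"
proof -
  have FP: "F \<subseteq> P"
    using assms(1) facet_of_imp_subset by blast
  have "affine hull F \<subseteq> {x. a \<bullet> x = 1}"
    using assms(3) by (intro hull_minimal) (auto simp: affine_hyperplane)
  then have "0 \<notin> affine hull F"
    by auto
  then have "aff_dim (insert 0 F) = aff_dim P"
    using assms(1) by (simp add: aff_dim_insert facet_of_def)
  moreover have "aff_dim (insert 0 F) = int (dim F)"
    using aff_dim_zero[of "insert 0 F"] by (simp add: hull_inc dim_insert span_zero)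
  moreover have "aff_dim P = int (dim P)"
    using assms(2) by (simp add: aff_dim_zero hull_inc)
  ultimately have "span F = span P"
    using FP by (intro dim_eq_span) auto
  then show ?thesis
    by (simp add: span_superset)
qed

text \<open>For every nonzero \<open>p\<close> in \<open>P\<close> the origin is interior to the
  segment from \<open>p\<close> to \<open>- p\<close>, so a face containing 0 also contains
  \<open>p\<close> and is therefore all of \<open>P\<close>.\<close>

lemma symmetric_proper_face_zero_notin:
  fixes P :: "'a::euclidean_space set"
  assumes "uminus ` P = P" "F face_of P" "F \<noteq> P"
  shows "0 \<notin> F"
proof
  assume "0 \<in> F"
  have "p \<in> F" if "p \<in> P" for p
  proof (cases "p = 0")
    case False
    have "- p \<in> P"
      using imageI[OF that, of uminus] assms(1) by simp
    moreover have "p \<noteq> - p"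
      using False scaleR_cancel_right[of 1 p "- 1"] by auto
    then have "0 \<in> open_segment p (- p)"
      using midpoint_in_open_segment[of p "- p"] by (simp add: midpoint_def)
    ultimately show ?thesis
      using assms(2) that \<open>0 \<in> F\<close> unfolding face_of_def by blast
  qed (use \<open>0 \<in> F\<close> in simp)
  then show False
    using assms face_of_imp_subset by blast
qed

lemma symmetric_proper_face_antipode:
  fixes P :: "'a::euclidean_space set"
  assumes "uminus ` P = P" "F face_of P" "F \<noteq> P" "x \<in> F"
  shows "- x \<notin> F"
proof
  assume "- x \<in> F"
  moreover have "convex F"
    using assms(2) face_of_imp_convex by blast
  ultimately have "midpoint x (- x) \<in> F"
    using assms(4) by (meson convex_contains_segment midpoint_in_closed_segment subsetD)
  then show False
    using symmetric_proper_face_zero_notin[OF assms(1-3)] by (simp add: midpoint_def)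
qed

lemma extreme_point_of_uminus:
  fixes P :: "'a::euclidean_space set"
  assumes "uminus ` P = P" "x extreme_point_of P"
  shows "- x extreme_point_of P"
proof -
  have "{- x} face_of P"
    using assms face_of_linear_image[of uminus "{x}" P]
    by (simp add: face_of_singleton module_hom_uminus linear_uminus)
  then show ?thesis
    by (simp add: face_of_singleton)
qed

section \<open>Vertices and maximal faces of the boundary complex\<close>

lemma extreme_points_of_face:
  fixes P :: "'a::euclidean_space set"
  assumes "F face_of P"
  shows "{v. v extreme_point_of F} = {v. v extreme_point_of P} \<inter> F"
  using extreme_point_of_face[OF assms] by (auto simp: extreme_point_of_def)

text \<open>The nonemptiness assumption excludes \<open>P = {0}\<close>, whose only proper face is
  empty, so that its extreme point is not a vertex of the boundary complex.\<close>

lemma vertices_boundary_complex: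
  fixes P :: "'a::euclidean_space set"
  assumes "polytope P" "uminus ` P = P" "vertices (boundary_complex P) \<noteq> {}"
  shows "vertices (boundary_complex P) = {v. v extreme_point_of P}"
proof (rule antisym)
  show "vertices (boundary_complex P) \<subseteq> {v. v extreme_point_of P}"
  proof
    fix v assume "v \<in> vertices (boundary_complex P)"
    then obtain F where "F face_of P" "{v} = {w. w extreme_point_of F}"
      by (auto simp: vertices_def boundary_complex_def)
    then show "v \<in> {v. v extreme_point_of P}"
      using extreme_points_of_face by blast
  qed
next
  obtain F w where F: "F face_of P" "F \<noteq> P" "{w} = {w. w extreme_point_of F}"
    using assms(3) by (auto simp: vertices_def boundary_complex_def)
  have w: "w \<in> F"
    using F(3) by (auto simp: extreme_point_of_def)
  show "{v. v extreme_point_of P} \<subseteq> vertices (boundary_complex P)"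
  proof
    fix v assume v: "v \<in> {v. v extreme_point_of P}"
    have "{v} \<noteq> P"
    proof
      assume "{v} = P"
      then have "F = P"
        using F(1) w face_of_imp_subset by blast
      then show False
        using F(2) by simp
    qed
    moreover have "{v} = {w. w extreme_point_of {v}}"
      by (auto simp: extreme_point_of_def)
    ultimately show "v \<in> vertices (boundary_complex P)"
      using v unfolding vertices_def boundary_complex_def
      by (auto simp: face_of_singleton intro!: exI[of _ "{v}"])
  qed
qed

lemma maximal_face_functional:
  fixes P :: "'a::euclidean_space set" and K :: "'v set set"
  assumes P: "polytope P" "uminus ` P = P"
    and K: "complex_on (vertices K) K"
    and f: "bij_betw f (vertices K) (vertices (boundary_complex P))"
    and fK: "(`) f ` K = boundary_complex P"
    and G: "G \<in> K" "G \<noteq> {}" and max: "\<And>H. H \<in> K \<Longrightarrow> G \<subseteq> H \<Longrightarrow> H = G"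
  obtains a where "\<And>w. w \<in> vertices K \<Longrightarrow> a \<bullet> f w \<le> 1"
    and "\<And>w. w \<in> vertices K \<Longrightarrow> a \<bullet> f w = 1 \<longleftrightarrow> w \<in> G"
    and "\<And>w. w \<in> vertices K \<Longrightarrow> f w \<in> span (f ` G)"
proof -
  have KV: "H \<subseteq> vertices K" if "H \<in> K" for H
    using K that by (auto simp: complex_on_def)
  have inj: "inj_on f (vertices K)" and img: "f ` vertices K = vertices (boundary_complex P)"
    using f by (auto simp: bij_betw_def)
  have ext: "vertices (boundary_complex P) = {v. v extreme_point_of P}"
    using P G KV[OF G(1)] img by (intro vertices_boundary_complex) auto
  obtain F0 where F0: "F0 face_of P" "F0 \<noteq> P" "f ` G = {v. v extreme_point_of F0}"
  proof -
    have "f ` G \<in> boundary_complex P"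
      using fK G by blast
    then show ?thesis
      using that by (auto simp: boundary_complex_def)
  qed
  have "F0 \<noteq> {}"
    using F0(3) G(2) by (auto simp: extreme_point_of_def)
  then obtain F where F: "F facet_of P" "F0 \<subseteq> F"
    using face_of_polyhedron_subset_facet[OF polytope_imp_polyhedron[OF P(1)] F0(1)] F0(2) by blast
  have Fface: "F face_of P"
    using F(1) facet_of_imp_face_of by blast
  have "F \<noteq> P"
    using F(1) facet_of_irrefl by blast
  then have "{v. v extreme_point_of F} \<in> (`) f ` K"
    unfolding fK boundary_complex_def using Fface by blast
  then obtain H where H: "H \<in> K" "f ` H = {v. v extreme_point_of F}"
    by auto
  have "f ` G \<subseteq> f ` H"
    unfolding F0(3) H(2) extreme_points_of_face[OF F0(1)]
      extreme_points_of_face[OF Fface]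
    using F(2) by blast
  then have "G \<subseteq> H"
    using inj KV[OF G(1)] KV[OF H(1)] by (meson inj_on_image_subset_iff)
  then have fG: "f ` G = {v. v extreme_point_of F}"
    using max H by blast
  obtain a where a: "\<And>x. x \<in> P \<Longrightarrow> a \<bullet> x \<le> 1" "F = P \<inter> {x. a \<bullet> x = 1}"
    using symmetric_polytope_facet_functional[OF P F(1)] by blast
  have fP: "f w extreme_point_of P" "f w \<in> P" if "w \<in> vertices K" for w
    using img ext that by (auto simp: extreme_point_of_def)
  have "0 \<in> P"
  proof -
    obtain p where p: "p \<in> P"
      using F0(1) \<open>F0 \<noteq> {}\<close> face_of_imp_subset by blast
    then have "- p \<in> P"
      using imageI[OF p, of uminus] P(2) by simp
    then have "midpoint p (- p) \<in> P"
      using p polytope_imp_convex[OF P(1)]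
      by (meson convex_contains_segment midpoint_in_closed_segment subsetD)
    then show ?thesis
      by (simp add: midpoint_def)
  qed
  have "F = convex hull (f ` G)"
    unfolding fG
    using Krein_Milman_Minkowski[of F] P(1) Fface face_of_polytope_polytope
      polytope_imp_compact polytope_imp_convex by blast
  then have "span F \<subseteq> span (f ` G)"
    by (simp add: convex_hull_subset_span span_minimal)
  moreover have "P \<subseteq> span F"
    using subset_span_facet[OF F(1) \<open>0 \<in> P\<close>] a(2) by blast
  ultimately have sp: "P \<subseteq> span (f ` G)"
    by blast
  show ?thesis
  proof
    fix w assume w: "w \<in> vertices K"
    show "a \<bullet> f w \<le> 1" and "f w \<in> span (f ` G)"
      using a(1) fP(2)[OF w] sp by auto
    have "a \<bullet> f w = 1 \<longleftrightarrow> f w \<in> f ` G"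
      using a(2) fG fP[OF w] extreme_points_of_face[OF Fface] by auto
    then show "a \<bullet> f w = 1 \<longleftrightarrow> w \<in> G"
      using inj_on_image_mem_iff[OF inj w KV[OF G(1)]] by simp
  qed
qed

section \<open>Comparing two coefficients of a linear relation\<close>

lemma linear_relation_coefficient_less:
  fixes v :: "'i \<Rightarrow> 'a::real_inner"
  assumes "finite I" "r \<in> I" "l \<in> I" "r \<noteq> l"
    and rel: "(\<Sum>i\<in>I. c i *\<^sub>R v i) = 0" and nz: "c r \<noteq> 0 \<or> c l \<noteq> 0"
    and eq: "\<And>i. i \<in> I - {r, l} \<Longrightarrow> a \<bullet> v i = b \<bullet> v i"
    and r: "a \<bullet> v r = 1" "b \<bullet> v r = - 1"
    and l: "\<bar>a \<bullet> v l\<bar> < 1" "\<bar>b \<bullet> v l\<bar> < 1"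
  shows "\<bar>c r\<bar> < \<bar>c l\<bar>"
proof -
  \<comment> \<open>Pairing the relation with \<open>a - b\<close> cancels every index except
    \<open>r\<close> and \<open>l\<close>. The factor at \<open>r\<close> is 2, the one at
    \<open>l\<close> has absolute value below 2.\<close>
  have "0 = (\<Sum>i\<in>I. c i * (a \<bullet> v i - b \<bullet> v i))"
    using arg_cong[OF rel, of "\<lambda>x. (a - b) \<bullet> x"] by (simp add: inner_sum_right inner_diff_left)
  also have "\<dots> = (\<Sum>i\<in>{r, l}. c i * (a \<bullet> v i - b \<bullet> v i))"
    using assms by (intro sum.mono_neutral_right) auto
  also have "\<dots> = 2 * c r + c l * (a \<bullet> v l - b \<bullet> v l)"
    using \<open>r \<noteq> l\<close> r by simp
  finally have *: "2 * c r = - (c l * (a \<bullet> v l - b \<bullet> v l))"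
    by simp
  then have "c l \<noteq> 0"
    using nz by auto
  have "2 * \<bar>c r\<bar> = \<bar>c l\<bar> * \<bar>a \<bullet> v l - b \<bullet> v l\<bar>"
    using arg_cong[OF *, of abs] by (simp add: abs_mult)
  also have "\<dots> < \<bar>c l\<bar> * 2"
    using l \<open>c l \<noteq> 0\<close> by (intro mult_strict_left_mono) auto
  finally show ?thesis
    by simp
qed

section \<open>Self-dual complexes and the faces of their Bier spheres\<close>

lemma mem_self_dual_iff:
  assumes "complex_on {1..n} \<Delta>" "\<Delta> = alexander_dual n \<Delta>"
  shows "\<sigma> \<in> \<Delta> \<longleftrightarrow> \<sigma> \<subseteq> {1..n} \<and> {1..n} - \<sigma> \<notin> \<Delta>"
proof -
  have "\<sigma> \<in> alexander_dual n \<Delta> \<longleftrightarrow> \<sigma> \<subseteq> {1..n} \<and> {1..n} - \<sigma> \<notin> \<Delta>"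
    unfolding alexander_dual_def by (auto simp: double_diff intro!: exI[of _ "{1..n} - \<sigma>"])
  then show ?thesis
    using assms(2) by simp
qed

lemma Plus_mem_bier_iff:
  assumes "\<Delta> = alexander_dual n \<Delta>"
  shows "\<sigma> <+> \<tau> \<in> bier n \<Delta> \<longleftrightarrow> \<sigma> \<in> \<Delta> \<and> \<tau> \<in> \<Delta> \<and> \<sigma> \<inter> \<tau> = {}"
proof -
  have inj: "\<sigma> <+> \<tau> = \<sigma>' <+> \<tau>' \<longleftrightarrow> \<sigma> = \<sigma>' \<and> \<tau> = \<tau>'" for \<sigma>' \<tau>' :: "nat set"
    by (auto simp: Plus_def)
  show ?thesis
    unfolding bier_def using assms[symmetric] by (auto simp: inj)
qed

text \<open>Two complementary sets are never both faces of a self-dual complex, so a face of the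
  Bier sphere omits some index. A face above \<open>\<sigma> <+> \<tau>\<close> can omit only
  \<open>m\<close>, and disjointness of its two parts then leaves no room to enlarge
  \<open>\<sigma>\<close> or \<open>\<tau>\<close>.\<close>

lemma bier_maximal_face:
  assumes \<Delta>: "complex_on {1..n} \<Delta>" "\<Delta> = alexander_dual n \<Delta>"
    and un: "\<sigma> \<union> \<tau> = {1..n} - {m}" and H: "H \<in> bier n \<Delta>" "\<sigma> <+> \<tau> \<subseteq> H"
  shows "H = \<sigma> <+> \<tau>"
proof -
  obtain \<sigma>' \<tau>' where H': "H = \<sigma>' <+> \<tau>'"
    using H(1) unfolding bier_def by blast
  then have st: "\<sigma>' \<in> \<Delta>" "\<tau>' \<in> \<Delta>" "\<sigma>' \<inter> \<tau>' = {}"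
    using H(1) Plus_mem_bier_iff[OF \<Delta>(2)] by auto
  have sub: "\<sigma> \<subseteq> \<sigma>'" "\<tau> \<subseteq> \<tau>'"
    using H(2) unfolding H' by auto
  have in_n: "\<sigma>' \<subseteq> {1..n}" "\<tau>' \<subseteq> {1..n}"
    using st mem_self_dual_iff[OF \<Delta>] by blast+
  have "\<tau>' \<noteq> {1..n} - \<sigma>'"
    using st mem_self_dual_iff[OF \<Delta>] by blast
  then have "\<sigma>' \<union> \<tau>' = {1..n} - {m}"
    using in_n st(3) sub un by blast
  then have "\<sigma>' = \<sigma>" "\<tau>' = \<tau>"
    using sub un st(3) by blast+
  then show ?thesis
    using H' by simp
qed

text \<open>Neighborliness speaks only of sets of exactly \<open>k\<close> vertices, so the pair is
  first enlarged to such a set without antipodes; closure under subsets then gives the edge.\<close>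

lemma cs_neighborly_bier_edge:
  assumes nb: "cs_neighborly k swap_xy (bier n \<Delta>)" and k: "2 \<le> k" "k \<le> n"
    and V: "vertices (bier n \<Delta>) = {1..n} <+> {1..n}"
    and vw: "v \<in> vertices (bier n \<Delta>)" "w \<in> vertices (bier n \<Delta>)" "w \<noteq> swap_xy v"
  shows "{v, w} \<in> bier n \<Delta>"
proof -
  define ix :: "nat + nat \<Rightarrow> nat" where "ix = case_sum id id"
  have ix: "ix (swap_xy u) = ix u" "swap_xy u \<noteq> u" for u
    by (auto simp: ix_def swap_xy_def split: sum.splits)
  have ixn: "ix v \<in> {1..n}" "ix w \<in> {1..n}"
    using vw V by (auto simp: ix_def)
  have same: "ix v = ix w \<Longrightarrow> v = w"
    using vw(3) by (auto simp: ix_def swap_xy_def split: sum.splits)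
  have "card {ix v, ix w} \<le> k"
    using k by (simp add: card_insert_if)
  then obtain T where T: "{ix v, ix w} \<subseteq> T" "T \<subseteq> {1..n}" "card T = k"
    using exists_subset_between[of "{ix v, ix w}" k "{1..n}"] ixn k by auto
  \<comment> \<open>One vertex is chosen for each index in \<open>T\<close>, which rules out
    antipodal pairs. On the indices of \<open>v\<close> and \<open>w\<close> these vertices
    themselves are taken; elsewhere \<open>Inl\<close> is an arbitrary choice.\<close>
  define sel where "sel t = (if t = ix v then v else if t = ix w then w else Inl t)" for t
  have ixsel: "ix (sel t) = t" for t
    by (simp add: sel_def) (simp add: ix_def)
  have sub: "{v, w} \<subseteq> sel ` T"
  proof -
    have "sel (ix v) = v" "sel (ix w) = w"
      using same by (auto simp: sel_def)
    then show ?thesis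
      using T(1) by force
  qed
  have "inj_on sel T"
    using ixsel by (metis inj_onI)
  then have card: "card (sel ` T) = k"
    using T(3) by (simp add: card_image)
  have fin: "finite (sel ` T)"
    using T(2) finite_subset by blast
  have ant: "swap_xy u \<notin> sel ` T" if "u \<in> sel ` T" for u
    using that ix ixsel by (metis imageE)
  have "sel t \<in> vertices (bier n \<Delta>)" if "t \<in> T" for t
    using that T(2) vw V by (auto simp: sel_def)
  then have "sel ` T \<in> bier n \<Delta>"
    using nb fin card ant unfolding cs_neighborly_def by blast
  moreover have "complex_on (vertices (bier n \<Delta>)) (bier n \<Delta>)"
    using nb unfolding cs_neighborly_def cs_complex_def by blast
  ultimately show ?thesis
    using sub unfolding complex_on_def by blast
qed

section \<open>Contradictory coefficient inequalities in a symmetric realization\<close>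

theorem proposition3p4:
  fixes n k r l :: nat and \<Delta> :: "nat set set" and C D :: "nat set"
  assumes "even n"
    and "complex_on {1..n} \<Delta>"
    and "\<Delta> = alexander_dual n \<Delta>"
    and "2 \<le> k" and "k \<le> (n - 2) div 2"
    and "cs_neighborly k swap_xy (bier n \<Delta>)"
    and "r \<in> {1..n}" and "l \<in> {1..n}" and "r \<noteq> l"
    and "C \<subseteq> {1..n} - {r, l}" and "D \<subseteq> {1..n} - {r, l}"
    and "card C = (n - 2) div 2" and "card D = (n - 2) div 2"
    and "C \<union> {r} \<in> \<Delta>" and "{1..n} - (C \<union> {l}) \<in> \<Delta>"
    and "D \<union> {l} \<in> \<Delta>" and "{1..n} - (D \<union> {r}) \<in> \<Delta>"
  shows "\<not> cs_polytopal_in TYPE(real ^ 'm) (bier n \<Delta>)"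
proof
  let ?K = "bier n \<Delta>"
  note \<Delta> = assms(2,3)
  note bier_iff = Plus_mem_bier_iff[OF \<Delta>(2)]
  assume "cs_polytopal_in TYPE(real ^ 'm) ?K"
  then obtain P :: "(real ^ 'm) set" where P: "polytope P" "uminus ` P = P"
    and iso: "complex_iso ?K (boundary_complex P)"
    unfolding cs_polytopal_in_def simplicial_polytope_def by auto
  from iso obtain f where f: "bij_betw f (vertices ?K) (vertices (boundary_complex P))"
    and fK: "(`) f ` ?K = boundary_complex P"
    unfolding complex_iso_def by auto
  have K: "complex_on (vertices ?K) ?K"
    using assms(6) unfolding cs_neighborly_def cs_complex_def by blast
  have down: "\<sigma> \<in> \<Delta>" if "\<tau> \<in> \<Delta>" "\<sigma> \<subseteq> \<tau>" for \<sigma> \<tau>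
    using \<Delta>(1) that unfolding complex_on_def by blast
  \<comment> \<open>Three of the given faces cover all indices: \<open>C \<union> {r}\<close>
    contains \<open>C\<close>, the complement of \<open>C \<union> {l}\<close> contains every other
    index except \<open>l\<close>, and \<open>D \<union> {l}\<close> contains
    \<open>l\<close>.\<close>
  have sing: "{i} \<in> \<Delta>" if "i \<in> {1..n}" for i
    using that down[OF assms(14), of "{i}"] down[OF assms(15), of "{i}"]
      down[OF assms(16), of "{i}"] by auto
  have empty: "{} \<in> \<Delta>"
    using down assms(14) by blast
  have V: "vertices ?K = {1..n} <+> {1..n}"
  proof -
    have \<Delta>n: "{i} \<in> \<Delta> \<longleftrightarrow> i \<in> {1..n}" for i
    proof
      show "{i} \<in> \<Delta> \<Longrightarrow> i \<in> {1..n}"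
        using \<Delta>(1) unfolding complex_on_def by blast
    qed (rule sing)
    have eq: "{Inl i} = {i} <+> {}" "{Inr i} = {} <+> {i}" for i :: nat
      by auto
    have mem: "{Inl i} \<in> ?K \<longleftrightarrow> i \<in> {1..n}" "{Inr i} \<in> ?K \<longleftrightarrow> i \<in> {1..n}" for i
      unfolding eq bier_iff using empty \<Delta>n by simp_all
    show ?thesis
    proof (rule set_eqI)
      show "u \<in> vertices ?K \<longleftrightarrow> u \<in> {1..n} <+> {1..n}" for u
        unfolding vertices_def mem_Collect_eq
        by (cases u) (auto simp: mem simp del: atLeastAtMost_iff)
    qed
  qed
  have ext: "vertices (boundary_complex P) = {v. v extreme_point_of P}"
    using P f V assms(7) by (intro vertices_boundary_complex) (auto simp: bij_betw_def)
  define v where "v i = f (Inl i)" for i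
  have fInr: "f (Inr i) = - v i" if i: "i \<in> {1..n}" for i
  proof -
    have x: "Inl i \<in> vertices ?K"
      unfolding V using i by (rule InlI)
    then have "v i extreme_point_of P"
      using f ext by (auto simp: v_def bij_betw_def)
    then have "- v i \<in> vertices (boundary_complex P)"
      using ext extreme_point_of_uminus[OF P(2)] by auto
    then obtain w where w: "w \<in> vertices ?K" "f w = - v i"
      using f unfolding bij_betw_def by (metis imageE)
    have "w = swap_xy (Inl i)"
    proof (rule ccontr)
      assume "w \<noteq> swap_xy (Inl i)"
      then have "{Inl i, w} \<in> ?K"
        using assms(4,5) by (intro cs_neighborly_bier_edge[OF assms(6) _ _ V x w(1)]) auto
      then have "f ` {Inl i, w} \<in> boundary_complex P"
        using fK by blast
      then obtain F where F: "F face_of P" "F \<noteq> P" "{v i, - v i} = {u. u extreme_point_of F}"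
        using w(2) by (auto simp: boundary_complex_def v_def)
      then have "v i \<in> F" "- v i \<in> F"
        by (auto simp: extreme_point_of_def)
      then show False
        using symmetric_proper_face_antipode[OF P(2) F(1,2)] by blast
    qed
    then show ?thesis
      using w(2) by (simp add: swap_xy_def)
  qed
  \<comment> \<open>A value 1 on the image of \<open>Inr i\<close> is a value -1 on
    \<open>v i\<close>. Neither vertex with index \<open>m\<close> lies on the facet, so the
    functional is below 1 on both \<open>v m\<close> and \<open>- v m\<close>. Signs do not affect
    spans, so the vectors with index other than \<open>m\<close> span \<open>v m\<close>.\<close>
  have facet: "\<exists>a. (\<forall>i\<in>\<sigma>. a \<bullet> v i = 1) \<and> (\<forall>i\<in>\<tau>. a \<bullet> v i = - 1) \<and> \<bar>a \<bullet> v m\<bar> < 1 \<and>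
      v m \<in> span (v ` ({1..n} - {m}))"
    if st: "\<sigma> \<in> \<Delta>" "\<tau> \<in> \<Delta>" "\<sigma> \<inter> \<tau> = {}" "\<sigma> \<union> \<tau> = {1..n} - {m}" and m: "m \<in> {1..n}"
    for \<sigma> \<tau> m
  proof -
    have G: "\<sigma> <+> \<tau> \<in> ?K"
      using st bier_iff by blast
    have "{1..n} - {m} \<noteq> {}"
      using assms(7-9) by blast
    then have ne: "\<sigma> <+> \<tau> \<noteq> {}"
      using st(4) by auto
    obtain a where a: "\<And>w. w \<in> vertices ?K \<Longrightarrow> a \<bullet> f w \<le> 1"
      "\<And>w. w \<in> vertices ?K \<Longrightarrow> a \<bullet> f w = 1 \<longleftrightarrow> w \<in> \<sigma> <+> \<tau>"
      "\<And>w. w \<in> vertices ?K \<Longrightarrow> f w \<in> span (f ` (\<sigma> <+> \<tau>))"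
      using maximal_face_functional[OF P K f fK G ne bier_maximal_face[OF \<Delta> st(4)]] by blast
    have sub: "\<sigma> \<subseteq> {1..n}" "\<tau> \<subseteq> {1..n}" "m \<notin> \<sigma>" "m \<notin> \<tau>"
      using st(4) by blast+
    have "a \<bullet> v i = 1" if "i \<in> \<sigma>" for i
      using a(2)[of "Inl i"] that sub V by (auto simp: v_def)
    moreover have "a \<bullet> v i = - 1" if "i \<in> \<tau>" for i
    proof -
      have "i \<in> {1..n}"
        using that sub by blast
      then show ?thesis
        using a(2)[of "Inr i"] that V by (simp add: fInr InrI)
    qed
    moreover have "\<bar>a \<bullet> v m\<bar> < 1"
    proof -
      have "Inl m \<in> vertices ?K" "Inr m \<in> vertices ?K"
        unfolding V using m by (rule InlI, rule InrI)
      then have "a \<bullet> v m \<le> 1" "a \<bullet> v m \<noteq> 1" "- (a \<bullet> v m) \<le> 1" "- (a \<bullet> v m) \<noteq> 1"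
        using a(1,2)[of "Inl m"] a(1,2)[of "Inr m"] sub fInr[OF m]
        by (auto simp: v_def)
      then show ?thesis
        by linarith
    qed
    moreover have "v m \<in> span (v ` ({1..n} - {m}))"
    proof -
      have "f w \<in> span (v ` ({1..n} - {m}))" if w: "w \<in> \<sigma> <+> \<tau>" for w
      proof (cases w)
        case (Inl i)
        then have "i \<in> \<sigma> \<union> \<tau>"
          using w by auto
        then have "i \<in> {1..n} - {m}"
          unfolding st(4) .
        then show ?thesis
          using Inl by (auto simp: v_def intro: span_base)
      next
        case (Inr i)
        then have "i \<in> \<sigma> \<union> \<tau>"
          using w by auto
        then have "i \<in> {1..n} - {m}"
          unfolding st(4) .
        then show ?thesis
          using Inr fInr by (auto intro!: span_base span_neg)
      qed
      then have "span (f ` (\<sigma> <+> \<tau>)) \<subseteq> span (v ` ({1..n} - {m}))"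
        by (intro span_minimal) auto
      moreover have "v m \<in> span (f ` (\<sigma> <+> \<tau>))"
        unfolding v_def using a(3) V m by blast
      ultimately show ?thesis
        by blast
    qed
    ultimately show ?thesis
      by blast
  qed
  \<comment> \<open>Stated for general \<open>p\<close>, \<open>q\<close>, \<open>B\<close> to serve
    both for \<open>r\<close>, \<open>l\<close>, \<open>C\<close> and for \<open>l\<close>,
    \<open>r\<close>, \<open>D\<close>. The two facets have \<open>Inl\<close> parts
    \<open>B \<union> {p}\<close> and \<open>B\<close>; their \<open>Inr\<close> parts consist of
    the remaining indices other than \<open>q\<close>.\<close>
  have facet_pair: "v q \<in> span (v ` ({1..n} - {q})) \<and>
      (\<forall>c. (\<Sum>i\<in>{1..n}. c i *\<^sub>R v i) = 0 \<longrightarrow> c p \<noteq> 0 \<or> c q \<noteq> 0 \<longrightarrow> \<bar>c p\<bar> < \<bar>c q\<bar>)"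
    if pq: "p \<in> {1..n}" "q \<in> {1..n}" "p \<noteq> q" and B: "B \<subseteq> {1..n} - {p, q}"
      "B \<union> {p} \<in> \<Delta>" "{1..n} - (B \<union> {q}) \<in> \<Delta>" for p q B
  proof -
    let ?B' = "{1..n} - (B \<union> {p, q})"
    have "B \<in> \<Delta>"
      by (rule down[OF B(2)]) blast
    have "?B' \<in> \<Delta>"
      by (rule down[OF B(3)]) blast
    then obtain a where a: "\<And>i. i \<in> B \<union> {p} \<Longrightarrow> a \<bullet> v i = 1" "\<And>i. i \<in> ?B' \<Longrightarrow> a \<bullet> v i = - 1"
      "\<bar>a \<bullet> v q\<bar> < 1" "v q \<in> span (v ` ({1..n} - {q}))"
      using facet[of "B \<union> {p}" ?B' q] pq B by blast
    obtain b where b: "\<And>i. i \<in> B \<Longrightarrow> b \<bullet> v i = 1"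
      "\<And>i. i \<in> {1..n} - (B \<union> {q}) \<Longrightarrow> b \<bullet> v i = - 1" "\<bar>b \<bullet> v q\<bar> < 1"
      using facet[of B "{1..n} - (B \<union> {q})" q] pq B \<open>B \<in> \<Delta>\<close> by blast
    have eq: "a \<bullet> v i = b \<bullet> v i" if "i \<in> {1..n} - {p, q}" for i
      using a(1,2)[of i] b(1,2)[of i] that by (cases "i \<in> B") auto
    have p: "a \<bullet> v p = 1" "b \<bullet> v p = - 1"
      using a(1)[of p] b(2)[of p] pq B(1) by auto
    show ?thesis
      using linear_relation_coefficient_less[OF _ pq _ _ eq p a(3) b(3)] a(4) by auto
  qed
  have "v l \<in> span (v ` ({1..n} - {l}))"
    using facet_pair[OF assms(7-10,14,15)] by blast
  \<comment> \<open>Injectivity turns a combination over the set of vectors into one over their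
    indices.\<close>
  moreover have inj: "inj_on v ({1..n} - {l})"
    using f V unfolding v_def bij_betw_def inj_on_def by blast
  ultimately obtain u where u: "v l = (\<Sum>i\<in>{1..n} - {l}. u (v i) *\<^sub>R v i)"
    by (auto simp: span_finite sum.reindex)
  \<comment> \<open>Moving \<open>v l\<close> to the other side gives it the coefficient -1. This
    makes the relation nontrivial at \<open>l\<close>, which suffices for both comparisons.\<close>
  define c where "c i = (if i = l then - 1 else u (v i))" for i
  have "(\<Sum>i\<in>{1..n}. c i *\<^sub>R v i) = c l *\<^sub>R v l + (\<Sum>i\<in>{1..n} - {l}. c i *\<^sub>R v i)"
    using assms(8) by (intro sum.remove) auto
  also have "\<dots> = 0"
    using u by (simp add: c_def)
  finally have rel: "(\<Sum>i\<in>{1..n}. c i *\<^sub>R v i) = 0" .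
  have nz: "c l \<noteq> 0"
    by (simp add: c_def)
  have "\<bar>c r\<bar> < \<bar>c l\<bar>"
    using facet_pair[OF assms(7-10,14,15)] rel nz by blast
  moreover have "\<bar>c l\<bar> < \<bar>c r\<bar>"
    using facet_pair[of l r D] assms(7-9,11,16,17) rel nz by (simp add: insert_commute)
  ultimately show False
    by simp
qed

end
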